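(* Let $1\le I<N$ and $1\le k\le I$. Let $$\dot\sigma_J(k)=\begin{cases}\dfrac{1}{(k-1)!}\dbinom{N}{J-1}\dfrac{(N-J)!\,(I-1)!}{(I-J)!} & \text{if } 1\le J\le I,\\ 0 & \text{if } J=I+1,\end{cases}$$ $$\dot\tau^\circ_J(I)=\begin{cases}\dbinom{N}{J-1}\dfrac{(N-J)!}{(I-J)!}\displaystyle\sum_{i=I-J+1}^{N-J}\frac1i & \text{when } 1\le J\le I,\\ \dfrac{N!}{I!\,(N-I)}=\dbinom{N}{J-1}(N-J)! & \text{when } J=I+1,\end{cases}$$ and $$\dot\tau^\circ_J(k)=\frac{(I-1)!}{(k-1)!}\,\dot\tau^\circ_J(I)+\dot\sigma_J(k)\sum_{i=k}^{I-1}\frac1i\qquad\text{when } k<I.$$ Then, as functions of $x$, $$\sum_{J=1}^{I+1}\dot\sigma_J(k)\,\dot R_J(x)=N!\sum_{J=1}^{I+1}\sigma_J(k)\,R_J(x)\quad\text{and}\quad \sum_{J=1}^{I+1}\dot\tau^\circ_J(k)\,\dot R_J(x)=N!\sum_{J=1}^{I+1}\tau^\circ_J(k)\,R_J(x).$$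
   Context: For $1\le J\le I+1$: $$R_J(x)=\frac{1}{N!\,(1-x)^{N-I}}\sum_{h=0}^{J-1}\binom Nh x^h(1-x)^{N-h},\qquad \dot R_J(x)=x^{J-1}(1-x)^{I-(J-1)}.$$ These are polynomials in $x$. Empty sums are $0$. Permutations are written as words; $\pi_i$ is the value in position $i$. A bottom-to-top maximum of a permutation is an entry whose position is to the right of the positions of all entries with smaller value. For $\pi\in\mathfrak{S}_N$, the $J$-statistic $J(\pi)$ is the value of the next (leftmost) bottom-to-top maximum in a position greater than $I$; it lies in $\{1,\dots,I+1\}$. The flattening of a sequence of $i$ distinct integers is the permutation in $\mathfrak{S}_i$ with the same relative order. A left-to-right maximum is an entry larger than all entries to its left. For $p\in\mathfrak{S}_k$, $\pi\in\mathfrak{S}_N$ is $p$-acceptable if the flattening of $\pi_1\cdots\pi_k$ equals $p$ and $\pi_k=N$. It is $p$-rejectable if the flattening of $\pi_1\cdots\pi_k$ equals $p$, the value $N$ lies in a position greater than $k$, and there are no left-to-right maxima of $\pi$ in positions strictly between $k$ and the position of $N$. For $k\le I$: $\sigma_J(k)$ is the number of $p$-acceptable $\pi\in\mathfrak{S}_N$ with $J(\pi)=J$, where $p\in\mathfrak{S}_k$ is any fixed prefix with $p_k=k$; $\tau^\circ_J(k)$ is the number of $p$-rejectable $\pi\in\mathfrak{S}_N$ with $J(\pi)=J$, where $p\in\mathfrak{S}_k$ is any fixed prefix. These do not depend on the choice of $p$. *)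

theory Defs
  imports
    Complex_Main
    "HOL-Combinatorics.Permutations"
    "HOL-Computational_Algebra.Polynomial"
begin

text \<open>
  Words: a permutation in \<open>\<SS>\<^sub>n\<close> is a function \<open>\<pi>\<close> with \<open>\<pi> permutes {1..n}\<close>; positions are
  1-based and \<open>\<pi> i\<close> is the value in position \<open>i\<close>.
\<close>

definition btt_maximum :: "nat \<Rightarrow> (nat \<Rightarrow> nat) \<Rightarrow> nat \<Rightarrow> bool" where
  "btt_maximum N \<pi> i \<longleftrightarrow> i \<in> {1..N} \<and> (\<forall>j\<in>{1..N}. \<pi> j < \<pi> i \<longrightarrow> j < i)"

definition ltr_maximum :: "(nat \<Rightarrow> nat) \<Rightarrow> nat \<Rightarrow> bool" where
  "ltr_maximum \<pi> i \<longleftrightarrow> (\<forall>j\<in>{1..<i}. \<pi> j < \<pi> i)"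

definition J_statistic :: "nat \<Rightarrow> nat \<Rightarrow> (nat \<Rightarrow> nat) \<Rightarrow> nat" where
  "J_statistic N I \<pi> = \<pi> (LEAST i. I < i \<and> btt_maximum N \<pi> i)"

text \<open>The flattening of the sequence \<open>s 1, \<dots>, s k\<close>: each entry is replaced by its rank.\<close>

definition flattening :: "nat \<Rightarrow> (nat \<Rightarrow> nat) \<Rightarrow> nat \<Rightarrow> nat" where
  "flattening k s i = (if i \<in> {1..k} then card {j \<in> {1..k}. s j \<le> s i} else i)"

lemma flattening_less_iff:
  assumes "i \<in> {1..k}" "j \<in> {1..k}"
  shows "flattening k s i < flattening k s j \<longleftrightarrow> s i < s j"
proof -
  have less: "flattening k s a < flattening k s b"
    if "a \<in> {1..k}" "b \<in> {1..k}" "s a < s b" for a b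
  proof -
    let ?A = "\<lambda>c. {l \<in> {1..k}. s l \<le> s c}"
    have "?A a \<subseteq> ?A b" "b \<in> ?A b" "b \<notin> ?A a"
      using that by auto
    then have "?A a \<subset> ?A b" by blast
    then have "card (?A a) < card (?A b)"
      by (intro psubset_card_mono) auto
    then show ?thesis
      using that by (simp add: flattening_def)
  qed
  have le: "flattening k s b \<le> flattening k s a"
    if "a \<in> {1..k}" "b \<in> {1..k}" "s b \<le> s a" for a b
  proof -
    have "card {l \<in> {1..k}. s l \<le> s b} \<le> card {l \<in> {1..k}. s l \<le> s a}"
      using that by (intro card_mono) auto
    then show ?thesis
      using that by (simp add: flattening_def)
  qed
  show ?thesis
    using less[of i j] le[of i j] assms by (meson leD leI)
qed

lemma flattening_permutes:
  assumes "inj_on s {1..k}"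
  shows "flattening k s permutes {1..k}"
proof (rule bij_imp_permutes)
  have inj: "inj_on (flattening k s) {1..k}"
  proof (rule inj_onI)
    fix i j assume ij: "i \<in> {1..k}" "j \<in> {1..k}" and eq: "flattening k s i = flattening k s j"
    have "s i = s j"
      using flattening_less_iff[OF ij, of s] flattening_less_iff[OF ij(2,1), of s] eq by linarith
    then show "i = j"
      using assms ij by (auto dest: inj_onD)
  qed
  have "flattening k s ` {1..k} \<subseteq> {1..k}"
  proof
    fix y assume "y \<in> flattening k s ` {1..k}"
    then obtain i where i: "i \<in> {1..k}" and "y = flattening k s i"
      by blast
    then have y: "y = card {j \<in> {1..k}. s j \<le> s i}"
      by (simp add: flattening_def)
    have "card {j \<in> {1..k}. s j \<le> s i} > 0"
      using i by (auto simp: card_gt_0_iff)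
    moreover have "card {j \<in> {1..k}. s j \<le> s i} \<le> card {1..k}"
      by (rule card_mono) auto
    ultimately show "y \<in> {1..k}" using y by simp
  qed
  then have "flattening k s ` {1..k} = {1..k}"
    using inj by (intro endo_inj_surj) auto
  then show "bij_betw (flattening k s) {1..k} {1..k}"
    using inj by (simp add: bij_betw_def)
qed (simp only: flattening_def if_False)

definition acceptable :: "nat \<Rightarrow> nat \<Rightarrow> (nat \<Rightarrow> nat) \<Rightarrow> (nat \<Rightarrow> nat) \<Rightarrow> bool" where
  "acceptable N k p \<pi> \<longleftrightarrow> flattening k \<pi> = p \<and> \<pi> k = N"

definition rejectable :: "nat \<Rightarrow> nat \<Rightarrow> (nat \<Rightarrow> nat) \<Rightarrow> (nat \<Rightarrow> nat) \<Rightarrow> bool" where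
  "rejectable N k p \<pi> \<longleftrightarrow> flattening k \<pi> = p \<and>
     (\<exists>m\<in>{k<..N}. \<pi> m = N \<and> (\<forall>i\<in>{k<..<m}. \<not> ltr_maximum \<pi> i))"

text \<open>
  The counts \<open>\<sigma>\<^sub>J(k)\<close> and \<open>\<tau>\<degree>\<^sub>J(k)\<close>; the choice of the prefix \<open>p\<close> is an explicit
  argument here.
\<close>

definition sigma :: "nat \<Rightarrow> nat \<Rightarrow> nat \<Rightarrow> (nat \<Rightarrow> nat) \<Rightarrow> nat \<Rightarrow> nat" where
  "sigma N I k p J =
     card {\<pi>. \<pi> permutes {1..N} \<and> acceptable N k p \<pi> \<and> J_statistic N I \<pi> = J}"

definition tau :: "nat \<Rightarrow> nat \<Rightarrow> nat \<Rightarrow> (nat \<Rightarrow> nat) \<Rightarrow> nat \<Rightarrow> nat" where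
  "tau N I k p J =
     card {\<pi>. \<pi> permutes {1..N} \<and> rejectable N k p \<pi> \<and> J_statistic N I \<pi> = J}"

text \<open>
  \<open>R\<^sub>J\<close> is a polynomial also at \<open>x = 1\<close>, so the quotient by \<open>(1 - x)\<^bsup>N-I\<^esup>\<close> is taken in the
  polynomial ring, where it is exact (for \<open>J \<le> I + 1\<close>), rather than pointwise.
  The polynomial \<open>[:0, 1:]\<close> is \<open>x\<close> and \<open>[:1, -1:]\<close> is \<open>1 - x\<close>.
\<close>

definition R_poly :: "nat \<Rightarrow> nat \<Rightarrow> nat \<Rightarrow> real poly" where
  "R_poly N I J =
     (\<Sum>h<J. smult (real (N choose h)) ([:0, 1:] ^ h * [:1, -1:] ^ (N - h)))
       div smult (fact N) ([:1, -1:] ^ (N - I))"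

definition R_dot_poly :: "nat \<Rightarrow> nat \<Rightarrow> real poly" where
  "R_dot_poly I J = [:0, 1:] ^ (J - 1) * [:1, -1:] ^ (I - (J - 1))"

lemma R_poly_exact:
  assumes "I < N" "J \<le> I + 1"
  shows "smult (fact N) ([:1, -1:] ^ (N - I)) * R_poly N I J =
           (\<Sum>h<J. smult (real (N choose h)) ([:0, 1:] ^ h * [:1, -1:] ^ (N - h)))"
  unfolding R_poly_def
proof (rule dvd_mult_div_cancel)
  have "[:1, -1::real:] ^ (N - I) dvd
          (\<Sum>h<J. smult (real (N choose h)) ([:0, 1:] ^ h * [:1, -1:] ^ (N - h)))"
    using assms by (intro dvd_sum dvd_smult dvd_mult le_imp_power_dvd) auto
  then show "smult (fact N) ([:1, -1::real:] ^ (N - I)) dvd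
          (\<Sum>h<J. smult (real (N choose h)) ([:0, 1:] ^ h * [:1, -1:] ^ (N - h)))"
    by (simp add: smult_dvd_iff)
qed

lemma poly_R_poly:
  assumes "I < N" "J \<le> I + 1" "x \<noteq> 1"
  shows "poly (R_poly N I J) x =
           1 / (fact N * (1 - x) ^ (N - I)) * (\<Sum>h<J. real (N choose h) * x ^ h * (1 - x) ^ (N - h))"
proof -
  have "poly (smult (fact N) ([:1, -1:] ^ (N - I)) * R_poly N I J) x =
          poly (\<Sum>h<J. smult (real (N choose h)) ([:0, 1:] ^ h * [:1, -1:] ^ (N - h))) x"
    using R_poly_exact[OF assms(1,2)] by simp
  then have "fact N * (1 - x) ^ (N - I) * poly (R_poly N I J) x =
               (\<Sum>h<J. real (N choose h) * x ^ h * (1 - x) ^ (N - h))"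
    by (simp add: poly_sum mult.assoc)
  moreover have "fact N * (1 - x) ^ (N - I) \<noteq> 0"
    using assms(3) by simp
  ultimately show ?thesis
    by (simp add: nonzero_eq_divide_eq mult.commute)
qed

definition sigma_dot :: "nat \<Rightarrow> nat \<Rightarrow> nat \<Rightarrow> nat \<Rightarrow> real" where
  "sigma_dot N I k J =
     (if J \<le> I
      then 1 / fact (k - 1) * real (N choose (J - 1)) * (fact (N - J) * fact (I - 1) / fact (I - J))
      else 0)"

definition tau_dot_top :: "nat \<Rightarrow> nat \<Rightarrow> nat \<Rightarrow> real" where
  "tau_dot_top N I J =
     (if J \<le> I
      then real (N choose (J - 1)) * (fact (N - J) / fact (I - J)) * (\<Sum>i = I - J + 1..N - J. 1 / real i)
      else fact N / (fact I * (real N - real I)))"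

text \<open>The two displayed forms of \<open>tau_dot_top\<close> at \<open>J = I + 1\<close> agree.\<close>

lemma tau_dot_top_last:
  assumes "I < N" "J = I + 1"
  shows "tau_dot_top N I J = real (N choose (J - 1)) * fact (N - J)"
proof -
  have "fact (N - I) = (real N - real I) * fact (N - J)"
    using assms by (simp add: fact_reduce)
  then show ?thesis
    using assms by (simp add: tau_dot_top_def binomial_fact)
qed

definition tau_dot :: "nat \<Rightarrow> nat \<Rightarrow> nat \<Rightarrow> nat \<Rightarrow> real" where
  "tau_dot N I k J =
     (if k < I
      then fact (I - 1) / fact (k - 1) * tau_dot_top N I J
             + sigma_dot N I k J * (\<Sum>i = k..I - 1. 1 / real i)
      else tau_dot_top N I J)"

end

theory Submission
  imports Defs
begin

text \<open>
  Summation by parts reduces each identity to the claim that its \<open>J\<close>-th coefficient on the left is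
  \<open>N choose (J - 1)\<close> times the number of permutations counted on the right that satisfy
  \<open>J(\<pi>) \<ge> J\<close>. As \<open>J(\<pi>)\<close> is the least value in a position greater than \<open>I\<close>, this condition
  says that all values below \<open>J\<close> lie in the first \<open>I\<close> positions. Rearranging the first \<open>k\<close> entries
  preserves the remaining conditions, so prescribing the prefix divides the counts by \<open>k!\<close>. What is
  left are permutations with a prescribed position \<open>m\<close> of \<open>N\<close> and, in the rejectable case, a
  prescribed position \<open>j \<le> k\<close> of the maximum of the first \<open>m - 1\<close> entries; they are counted by
  exchanging two positions or two values.
\<close>

section \<open>Comparison of coefficients\<close>

text \<open>Every \<open>h < J\<close> satisfies \<open>h \<le> I\<close>, so each summand of the
  dividend contains the full factor \<open>(1 - x) ^ (N - I)\<close> and the division can be carried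
  out term by term. The resulting form is valid at \<open>x = 1\<close> as well.\<close>

lemma R_poly_eq_sum:
  assumes "I < N" "J \<le> I + 1"
  shows "R_poly N I J =
    (\<Sum>h<J. smult (real (N choose h) / fact N) ([:0, 1:] ^ h * [:1, -1:] ^ (I - h)))"
    (is "_ = ?S")
proof -
  let ?D = "smult (fact N) ([:1, -1:] ^ (N - I)) :: real poly"
  have "smult (real (N choose h)) ([:0, 1:] ^ h * [:1, -1:] ^ (N - h)) =
      ?D * smult (real (N choose h) / fact N) ([:0, 1:] ^ h * [:1, -1:] ^ (I - h))"
    if "h < J" for h
  proof -
    have "N - h = (N - I) + (I - h)"
      using that assms by simp
    then show ?thesis
      by (simp only: power_add) (simp add: mult_ac)
  qed
  then have "?D * R_poly N I J = ?D * ?S"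
    unfolding R_poly_exact[OF assms] sum_distrib_left by simp
  then show ?thesis
    by (subst (asm) mult_cancel_left) simp
qed

text \<open>Abel summation: \<open>fact N * R_poly N I L\<close> is a partial sum of the
  \<open>R_dot_poly I J\<close>, \<open>J \<le> L\<close>, weighted by
  \<open>N choose (J - 1)\<close>. Exchanging the two sums collects the tail of \<open>s\<close>
  from \<open>J\<close> on.\<close>

lemma sum_R_dot_poly_eq_sum_R_poly:
  assumes "I < N"
    and coeff: "\<And>J. 1 \<le> J \<Longrightarrow> J \<le> I + 1 \<Longrightarrow> a J = real (N choose (J - 1)) * (\<Sum>L = J..I + 1. s L)"
  shows "(\<Sum>J = 1..I + 1. a J * poly (R_dot_poly I J) x) =
    fact N * (\<Sum>J = 1..I + 1. s J * poly (R_poly N I J) x)"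
proof -
  \<comment> \<open>Up to the binomial weight this is \<open>R_dot_poly I (h + 1)\<close> at
    \<open>x\<close>, whence the shift in \<open>b (J - 1)\<close> below.\<close>
  define b where "b h = real (N choose h) * (x ^ h * (1 - x) ^ (I - h))" for h
  have R: "fact N * poly (R_poly N I L) x = (\<Sum>J = 1..L. b (J - 1))" if "L \<in> {1..I + 1}" for L
  proof -
    have "fact N * poly (R_poly N I L) x = (\<Sum>h<L. b h)"
      using that by (simp add: R_poly_eq_sum[OF \<open>I < N\<close>] poly_sum sum_distrib_left b_def)
    also have "\<dots> = (\<Sum>J = 1..L. b (J - 1))"
      by (rule sum.reindex_bij_witness[of _ "\<lambda>J. J - 1" Suc]) auto
    finally show ?thesis .
  qed
  have "fact N * (\<Sum>L = 1..I + 1. s L * poly (R_poly N I L) x) =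
      (\<Sum>L = 1..I + 1. s L * (fact N * poly (R_poly N I L) x))"
    by (simp only: sum_distrib_left mult_ac)
  also have "\<dots> = (\<Sum>L = 1..I + 1. \<Sum>J = 1..L. s L * b (J - 1))"
    by (intro sum.cong) (simp_all only: R sum_distrib_left)
  also have "\<dots> = (\<Sum>J = 1..I + 1. \<Sum>L = J..I + 1. s L * b (J - 1))"
    unfolding sum.Sigma[OF finite_atLeastAtMost ballI[OF finite_atLeastAtMost]]
    by (rule sum.reindex_bij_witness[of _ "\<lambda>(J, L). (L, J)" "\<lambda>(J, L). (L, J)"]) auto
  also have "\<dots> = (\<Sum>J = 1..I + 1. a J * poly (R_dot_poly I J) x)"
  proof (intro sum.cong refl)
    fix J assume J: "J \<in> {1..I + 1}"
    show "(\<Sum>L = J..I + 1. s L * b (J - 1)) = a J * poly (R_dot_poly I J) x"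
      using J
      by (simp only: coeff atLeastAtMost_iff R_dot_poly_def b_def poly_mult poly_power)
        (simp only: sum_distrib_left sum_distrib_right, simp add: mult_ac)
  qed
  finally show ?thesis by simp
qed

section \<open>The \<open>J\<close>-statistic and the flattening\<close>

text \<open>The position of the least value beyond \<open>I\<close> is a bottom-to-top maximum,
  because all smaller values sit in the first \<open>I\<close> positions. Any other bottom-to-top
  maximum beyond \<open>I\<close> has a larger value and therefore lies further right.\<close>

lemma J_statistic_eq_Min:
  assumes \<pi>: "\<pi> permutes {1..N}" and "I < N"
  shows "J_statistic N I \<pi> = Min (\<pi> ` {I<..N})"
proof -
  have "Min (\<pi> ` {I<..N}) \<in> \<pi> ` {I<..N}"
    using \<open>I < N\<close> by (intro Min_in) auto
  then obtain i where i: "i \<in> {I<..N}" "\<pi> i = Min (\<pi> ` {I<..N})"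
    by auto
  have le: "\<pi> i \<le> \<pi> l" if "l \<in> {I<..N}" for l
    using that unfolding i(2) by (intro Min_le) auto
  have "(LEAST i. I < i \<and> btt_maximum N \<pi> i) = i"
  proof (rule Least_equality)
    show "I < i \<and> btt_maximum N \<pi> i"
    proof -
      have "l < i" if "l \<in> {1..N}" "\<pi> l < \<pi> i" for l
      proof (rule ccontr)
        assume "\<not> l < i"
        then have "l \<in> {I<..N}"
          using i(1) that by auto
        then show False
          using le that by fastforce
      qed
      then show ?thesis
        using i(1) by (auto simp: btt_maximum_def)
    qed
    show "i \<le> l" if "I < l \<and> btt_maximum N \<pi> l" for l
    proof (cases "l = i")
      case False
      then have "\<pi> i \<noteq> \<pi> l"
        using permutes_inj[OF \<pi>] by (auto dest: injD)
      moreover have "\<pi> i \<le> \<pi> l"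
        using that by (intro le) (auto simp: btt_maximum_def)
      ultimately have "\<pi> i < \<pi> l"
        by simp
      then have "i < l"
        using that i(1) by (auto simp: btt_maximum_def)
      then show ?thesis
        by simp
    qed simp
  qed
  then show ?thesis
    by (simp add: J_statistic_def i(2))
qed

lemma le_J_statistic_iff:
  assumes "\<pi> permutes {1..N}" "I < N"
  shows "J \<le> J_statistic N I \<pi> \<longleftrightarrow> (\<forall>i\<in>{I<..N}. J \<le> \<pi> i)"
  using assms(2) by (subst J_statistic_eq_Min[OF assms]) (auto simp: Min_ge_iff)

lemma card_less_permutes:
  assumes \<pi>: "\<pi> permutes {1..N}" and "J \<le> N + 1"
  shows "card {i \<in> {1..N}. \<pi> i < J} = J - 1"
proof -
  have "bij_betw \<pi> {i \<in> {1..N}. \<pi> i < J} {1..<J}"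
  proof (rule bij_betw_imageI)
    show "inj_on \<pi> {i \<in> {1..N}. \<pi> i < J}"
      using permutes_inj[OF \<pi>] by (rule inj_on_subset) simp
    show "\<pi> ` {i \<in> {1..N}. \<pi> i < J} = {1..<J}"
    proof (intro equalityI subsetI)
      fix v assume v: "v \<in> {1..<J}"
      then have "v \<in> \<pi> ` {1..N}"
        using \<open>J \<le> N + 1\<close> by (subst permutes_image[OF \<pi>]) auto
      then show "v \<in> \<pi> ` {i \<in> {1..N}. \<pi> i < J}"
        using v by auto
    next
      fix v assume "v \<in> \<pi> ` {i \<in> {1..N}. \<pi> i < J}"
      then obtain i where i: "i \<in> {1..N}" "\<pi> i < J" "v = \<pi> i"
        by blast
      then show "v \<in> {1..<J}"
        using permutes_in_image[OF \<pi>, of i] by simp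
    qed
  qed
  then show ?thesis
    by (auto dest: bij_betw_same_card)
qed

text \<open>Upper bound by pigeonhole: the \<open>I + 1\<close> values below \<open>I + 2\<close> do
  not fit into the first \<open>I\<close> positions. Hence tail sums up to \<open>I + 1\<close> miss
  no permutation.\<close>

lemma J_statistic_in_range:
  assumes \<pi>: "\<pi> permutes {1..N}" and "I < N"
  shows "J_statistic N I \<pi> \<in> {1..I + 1}"
proof -
  have "1 \<le> J_statistic N I \<pi>"
    unfolding le_J_statistic_iff[OF assms]
    using permutes_in_image[OF \<pi>] by fastforce
  moreover have "\<not> I + 2 \<le> J_statistic N I \<pi>"
  proof
    assume "I + 2 \<le> J_statistic N I \<pi>"
    then have "\<forall>i\<in>{I<..N}. I + 2 \<le> \<pi> i"
      using assms by (simp add: le_J_statistic_iff)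
    then have "{i \<in> {1..N}. \<pi> i < I + 2} \<subseteq> {1..I}"
      by (fastforce simp flip: not_less)
    then have "card {i \<in> {1..N}. \<pi> i < I + 2} \<le> card {1..I}"
      by (intro card_mono) auto
    moreover have "card {i \<in> {1..N}. \<pi> i < I + 2} = I + 1"
      using \<open>I < N\<close> by (subst card_less_permutes[OF \<pi>]) auto
    ultimately show False
      by simp
  qed
  ultimately show ?thesis
    by simp
qed

lemma finite_permutes_Collect [simp]: "finite {\<pi>. \<pi> permutes {l..n::nat} \<and> Q \<pi>}"
  by (rule finite_subset[OF _ finite_permutations[of "{l..n}"]]) auto

lemma sum_card_J_statistic:
  assumes "I < N"
  shows "(\<Sum>L = J..I + 1. card {\<pi>. \<pi> permutes {1..N} \<and> Q \<pi> \<and> J_statistic N I \<pi> = L}) =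
    card {\<pi>. \<pi> permutes {1..N} \<and> Q \<pi> \<and> J \<le> J_statistic N I \<pi>}"
proof -
  have "(\<Sum>L = J..I + 1. card {\<pi>. \<pi> permutes {1..N} \<and> Q \<pi> \<and> J_statistic N I \<pi> = L}) =
      card (\<Union>L\<in>{J..I + 1}. {\<pi>. \<pi> permutes {1..N} \<and> Q \<pi> \<and> J_statistic N I \<pi> = L})"
    by (subst card_UN_disjoint) auto
  also have "(\<Union>L\<in>{J..I + 1}. {\<pi>. \<pi> permutes {1..N} \<and> Q \<pi> \<and> J_statistic N I \<pi> = L}) =
      {\<pi>. \<pi> permutes {1..N} \<and> Q \<pi> \<and> J \<le> J_statistic N I \<pi>}"
    using J_statistic_in_range[OF _ \<open>I < N\<close>] by auto
  finally show ?thesis .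
qed

section \<open>Rearranging the prefix\<close>

text \<open>Rearranging the first \<open>k\<close> positions leaves the set of their entries
  unchanged, so every entry keeps its rank.\<close>

lemma flattening_comp:
  assumes \<rho>: "\<rho> permutes {1..k}"
  shows "flattening k (\<pi> \<circ> \<rho>) = flattening k \<pi> \<circ> \<rho>"
proof
  fix i
  show "flattening k (\<pi> \<circ> \<rho>) i = (flattening k \<pi> \<circ> \<rho>) i"
  proof (cases "i \<in> {1..k}")
    case True
    have "{j \<in> {1..k}. \<pi> j \<le> \<pi> (\<rho> i)} = \<rho> ` {j \<in> {1..k}. \<pi> (\<rho> j) \<le> \<pi> (\<rho> i)}"
    proof (intro equalityI subsetI)
      fix j assume j: "j \<in> {j \<in> {1..k}. \<pi> j \<le> \<pi> (\<rho> i)}"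
      then obtain l where "l \<in> {1..k}" "j = \<rho> l"
        using permutes_image[OF \<rho>] by blast
      then show "j \<in> \<rho> ` {j \<in> {1..k}. \<pi> (\<rho> j) \<le> \<pi> (\<rho> i)}"
        using j by blast
    qed (use permutes_in_image[OF \<rho>] in auto)
    moreover have "inj_on \<rho> {j \<in> {1..k}. \<pi> (\<rho> j) \<le> \<pi> (\<rho> i)}"
      using permutes_inj[OF \<rho>] by (rule inj_on_subset) simp
    ultimately have "card {j \<in> {1..k}. \<pi> j \<le> \<pi> (\<rho> i)} =
        card {j \<in> {1..k}. \<pi> (\<rho> j) \<le> \<pi> (\<rho> i)}"
      by (simp add: card_image)
    then show ?thesis
      using True permutes_in_image[OF \<rho>, of i] by (simp add: flattening_def)
  next
    case False
    then show ?thesis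
      using permutes_not_in[OF \<rho> False] by (auto simp: flattening_def)
  qed
qed

text \<open>Composition with \<open>inv r \<circ> r'\<close> on the right injects the fibre of
  \<open>flattening k\<close> over \<open>r\<close> into the fibre over \<open>r'\<close>. All
  \<open>fact k\<close> fibres therefore have the same size.\<close>

lemma card_flattening_fibre:
  assumes q: "q permutes {1..k}" and "k \<le> N"
    and Q: "\<And>\<pi> \<rho>. \<pi> permutes {1..N} \<Longrightarrow> \<rho> permutes {1..k} \<Longrightarrow> Q \<pi> \<Longrightarrow> Q (\<pi> \<circ> \<rho>)"
  shows "fact k * card {\<pi>. \<pi> permutes {1..N} \<and> flattening k \<pi> = q \<and> Q \<pi>} =
    card {\<pi>. \<pi> permutes {1..N} \<and> Q \<pi>}"
proof -
  define F where "F r = {\<pi>. \<pi> permutes {1..N} \<and> flattening k \<pi> = r \<and> Q \<pi>}" for r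
  let ?P = "{r. r permutes {1..k}}"
  have le: "card (F r) \<le> card (F r')" if r: "r \<in> ?P" "r' \<in> ?P" for r r'
  proof (rule card_inj_on_le)
    let ?\<rho> = "inv r \<circ> r'"
    have \<rho>: "?\<rho> permutes {1..k}"
      using r by (auto intro: permutes_compose permutes_inv)
    then have \<rho>N: "?\<rho> permutes {1..N}"
      by (rule permutes_subset) (use \<open>k \<le> N\<close> in auto)
    show "inj_on (\<lambda>\<pi>. \<pi> \<circ> ?\<rho>) (F r)"
      using permutes_surj[OF \<rho>] by (intro inj_onI) (metis surj_fun_eq image_subset_iff)
    show "(\<lambda>\<pi>. \<pi> \<circ> ?\<rho>) ` F r \<subseteq> F r'"
    proof
      fix \<pi>' assume "\<pi>' \<in> (\<lambda>\<pi>. \<pi> \<circ> ?\<rho>) ` F r"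
      then obtain \<pi> where \<pi>: "\<pi> \<in> F r" "\<pi>' = \<pi> \<circ> ?\<rho>"
        by blast
      have "r \<circ> ?\<rho> = r'"
        using r permutes_inv_o(1)[of r "{1..k}"] by (simp add: comp_assoc[symmetric])
      then show "\<pi>' \<in> F r'"
        using \<pi> Q[OF _ \<rho>] \<rho>N permutes_compose[OF \<rho>N]
        by (simp add: F_def flattening_comp[OF \<rho>])
    qed
    show "finite (F r')"
      by (simp add: F_def)
  qed
  have "{\<pi>. \<pi> permutes {1..N} \<and> Q \<pi>} = (\<Union>r\<in>?P. F r)"
  proof -
    have "flattening k \<pi> permutes {1..k}" if "\<pi> permutes {1..N}" for \<pi>
      using permutes_inj[OF that] by (intro flattening_permutes) (rule inj_on_subset, auto)
    then show ?thesis
      by (auto simp: F_def)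
  qed
  also have "card \<dots> = (\<Sum>r\<in>?P. card (F r))"
    by (subst card_UN_disjoint) (auto simp: F_def finite_permutations)
  also have "\<dots> = (\<Sum>r\<in>?P. card (F q))"
    using q by (intro sum.cong refl antisym le) auto
  also have "\<dots> = fact k * card (F q)"
    by (simp add: card_permutations)
  finally show ?thesis
    by (simp add: F_def)
qed

section \<open>Permutations with small values in prescribed positions\<close>

text \<open>\<open>P\<close> is the set of positions where values below \<open>J\<close> are
  allowed. With \<open>P = {1..I}\<close> this expresses
  \<open>J \<le> J_statistic N I \<pi>\<close>; deleting a position from \<open>P\<close> forces a
  value of at least \<open>J\<close> there.\<close>

definition low_in :: "nat \<Rightarrow> nat set \<Rightarrow> nat \<Rightarrow> nat \<Rightarrow> (nat \<Rightarrow> nat) set" where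
  "low_in N P J m = {\<pi>. \<pi> permutes {1..N} \<and> (\<forall>i\<in>{1..N} - P. J \<le> \<pi> i) \<and> \<pi> m = N}"

lemma finite_low_in [simp]: "finite (low_in N P J m)"
  by (simp add: low_in_def)

lemma card_eq_involution:
  assumes "\<And>x. x \<in> A \<Longrightarrow> f x \<in> B" "\<And>x. x \<in> B \<Longrightarrow> f x \<in> A" "\<And>x. f (f x) = x"
  shows "card A = card B"
  by (rule bij_betw_same_card[of f]) (rule bij_betw_byWitness[of _ f], use assms in auto)

lemma comp_transpose_comp_transpose [simp]:
  "\<pi> \<circ> Transposition.transpose a b \<circ> Transposition.transpose a b = \<pi>"
  by (simp add: comp_assoc)

lemma transpose_comp_transpose_comp [simp]:
  "Transposition.transpose a b \<circ> (Transposition.transpose a b \<circ> \<pi>) = \<pi>"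
  by (simp add: comp_assoc[symmetric])

lemma permutes_comp_transpose:
  assumes "\<pi> permutes A" "a \<in> A" "b \<in> A"
  shows "\<pi> \<circ> Transposition.transpose a b permutes A"
    and "Transposition.transpose a b \<circ> \<pi> permutes A"
  using assms by (auto intro: permutes_compose permutes_swap_id)

text \<open>For \<open>J = 1\<close> the condition on values is vacuous. Exchanging positions shows
  that the count does not depend on the position of \<open>N\<close>, and the counts for all
  \<open>N\<close> positions add up to \<open>fact N\<close>.\<close>

lemma card_low_in_1:
  assumes "m \<in> {1..N}"
  shows "card (low_in N P 1 m) = fact (N - 1)"
proof -
  have mem: "\<pi> \<in> low_in N P 1 l \<longleftrightarrow> \<pi> permutes {1..N} \<and> \<pi> l = N" for \<pi> l
  proof -
    have "1 \<le> \<pi> i" if "\<pi> permutes {1..N}" "i \<in> {1..N}" for i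
      using permutes_in_image[OF that(1), of i] that(2) by simp
    then show ?thesis
      by (auto simp: low_in_def)
  qed
  have "card (low_in N P 1 l) = card (low_in N P 1 m)" if "l \<in> {1..N}" for l
  proof (rule card_eq_involution[of _ "\<lambda>\<pi>. \<pi> \<circ> Transposition.transpose l m"])
    fix \<pi>
    show "\<pi> \<in> low_in N P 1 l \<Longrightarrow> \<pi> \<circ> Transposition.transpose l m \<in> low_in N P 1 m"
      and "\<pi> \<in> low_in N P 1 m \<Longrightarrow> \<pi> \<circ> Transposition.transpose l m \<in> low_in N P 1 l"
      unfolding mem using permutes_comp_transpose(1)[OF _ that assms] by simp_all
  qed simp
  then have "N * card (low_in N P 1 m) = (\<Sum>l = 1..N. card (low_in N P 1 l))"
    by simp
  also have "\<dots> = card (\<Union>l\<in>{1..N}. low_in N P 1 l)"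
  proof (subst card_UN_disjoint)
    show "\<forall>i\<in>{1..N}. \<forall>j\<in>{1..N}. i \<noteq> j \<longrightarrow> low_in N P 1 i \<inter> low_in N P 1 j = {}"
      unfolding disjoint_iff mem by (metis permutes_def)
  qed auto
  also have "(\<Union>l\<in>{1..N}. low_in N P 1 l) = {\<pi>. \<pi> permutes {1..N}}"
  proof (intro equalityI subsetI)
    fix \<pi> assume "\<pi> \<in> {\<pi>. \<pi> permutes {1..N}}"
    then have \<pi>: "\<pi> permutes {1..N}" by simp
    then have "N \<in> \<pi> ` {1..N}"
      using assms by (subst permutes_image[OF \<pi>]) auto
    then show "\<pi> \<in> (\<Union>l\<in>{1..N}. low_in N P 1 l)"
      using \<pi> unfolding UN_iff mem by fastforce
  qed (auto simp: low_in_def)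
  also have "card \<dots> = N * fact (N - 1)"
    using assms by (subst card_permutations[of _ N]) (auto simp: fact_reduce)
  finally show ?thesis
    using assms by simp
qed

lemma low_values_subset_image:
  assumes "\<pi> \<in> low_in N P J m" "J \<le> N"
  shows "{1..<J} \<subseteq> \<pi> ` P"
proof
  fix v assume v: "v \<in> {1..<J}"
  have \<pi>: "\<pi> permutes {1..N}"
    using assms by (simp add: low_in_def)
  have "v \<in> \<pi> ` {1..N}"
    using v assms by (subst permutes_image[OF \<pi>]) auto
  then show "v \<in> \<pi> ` P"
    using v assms(1) by (force simp: low_in_def)
qed

text \<open>Pigeonhole: the \<open>J - 1\<close> values below \<open>J\<close> would all have to fit
  into \<open>P\<close>.\<close>

lemma low_in_empty:
  assumes "finite P" "card P + 1 < J" "J \<le> N"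
  shows "low_in N P J m = {}"
proof (rule ccontr)
  assume "low_in N P J m \<noteq> {}"
  then obtain \<pi> where "\<pi> \<in> low_in N P J m"
    by blast
  then have "card {1..<J} \<le> card (\<pi> ` P)"
    using assms by (intro card_mono low_values_subset_image) auto
  also have "\<dots> \<le> card P"
    by (rule card_image_le) fact
  finally show False
    using assms by simp
qed

text \<open>Double counting of the pairs of a permutation with a value \<open>w\<close>, \<open>J \<le> w < N\<close>, that lies in \<open>P\<close>;
  exchanging the values \<open>J\<close> and \<open>w\<close> shows that the count does not depend on \<open>w\<close>.\<close>

lemma card_low_in_Suc:
  assumes P: "P \<subseteq> {1..N} - {m}" and J: "1 \<le> J" "J < N"
  shows "(N - J) * card (low_in N P (J + 1) m) = (card P + 1 - J) * card (low_in N P J m)"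
proof -
  have finP: "finite P"
    using P by (rule finite_subset) simp
  have "(\<Sum>\<pi>\<in>low_in N P J m. card {w \<in> {J..<N}. w \<in> \<pi> ` P}) =
      card (low_in N P (J + 1) m) * card {J..<N}"
  proof (rule sum_multicount)
    show "\<forall>w\<in>{J..<N}. card {\<pi> \<in> low_in N P J m. w \<in> \<pi> ` P} = card (low_in N P (J + 1) m)"
    proof
      fix w assume w: "w \<in> {J..<N}"
      let ?t = "Transposition.transpose J w"
      show "card {\<pi> \<in> low_in N P J m. w \<in> \<pi> ` P} = card (low_in N P (J + 1) m)"
      proof (rule card_eq_involution[of _ "\<lambda>\<pi>. ?t \<circ> \<pi>"])
        fix \<pi> assume \<pi>: "\<pi> \<in> {\<pi> \<in> low_in N P J m. w \<in> \<pi> ` P}"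
        then obtain a where a: "a \<in> P" "\<pi> a = w" by auto
        from \<pi> have perm: "\<pi> permutes {1..N}" and "\<pi> m = N"
          and le: "\<And>i. i \<in> {1..N} - P \<Longrightarrow> J \<le> \<pi> i"
          by (auto simp: low_in_def)
        have "J + 1 \<le> ?t (\<pi> i)" if i: "i \<in> {1..N} - P" for i
        proof -
          \<comment> \<open>The value \<open>w\<close> is already taken by the position
            \<open>a\<close> in \<open>P\<close>, so the exchange cannot bring \<open>J\<close>
            outside \<open>P\<close>.\<close>
          have "\<pi> i \<noteq> w"
            using a i permutes_inj[OF perm] by (auto dest: injD)
          then show ?thesis
            using le[OF i] w by (cases "\<pi> i = J") (auto simp: transpose_def)
        qed
        then show "?t \<circ> \<pi> \<in> low_in N P (J + 1) m"
          using w J \<open>\<pi> m = N\<close> permutes_comp_transpose(2)[OF perm, of J w]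
          by (auto simp: low_in_def)
      next
        fix \<pi> assume \<pi>: "\<pi> \<in> low_in N P (J + 1) m"
        then have "J \<in> \<pi> ` P"
          using J low_values_subset_image[OF \<pi>] by auto
        then have "w \<in> (?t \<circ> \<pi>) ` P"
          by (force simp: image_iff)
        moreover have "?t \<circ> \<pi> permutes {1..N}"
          using \<pi> w J by (intro permutes_comp_transpose) (auto simp: low_in_def)
        moreover have "J \<le> (?t \<circ> \<pi>) i" if "i \<in> {1..N} - P" for i
        proof -
          have "J + 1 \<le> \<pi> i"
            using \<pi> that by (auto simp: low_in_def)
          then show ?thesis
            using w by (auto simp: transpose_def)
        qed
        moreover have "(?t \<circ> \<pi>) m = N"
          using \<pi> w J by (auto simp: low_in_def)
        ultimately show "?t \<circ> \<pi> \<in> {\<pi> \<in> low_in N P J m. w \<in> \<pi> ` P}"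
          by (simp add: low_in_def)
      qed simp
    qed
  qed auto
  \<comment> \<open>The image of \<open>P\<close> avoids \<open>N\<close>, since \<open>m\<close> is
    not in \<open>P\<close>, and contains all \<open>J - 1\<close> values below \<open>J\<close>;
    the remaining values are those counted here.\<close>
  moreover have "card {w \<in> {J..<N}. w \<in> \<pi> ` P} = card P + 1 - J" if \<pi>: "\<pi> \<in> low_in N P J m" for \<pi>
  proof -
    from \<pi> have perm: "\<pi> permutes {1..N}" and "\<pi> m = N"
      by (auto simp: low_in_def)
    have "\<pi> i \<in> {1..<N}" if "i \<in> P" for i
    proof -
      have "\<pi> i \<noteq> \<pi> m"
        using that P permutes_inj[OF perm] by (auto dest: injD)
      moreover have "\<pi> i \<in> {1..N}"
        using that P permutes_in_image[OF perm] by auto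
      ultimately show ?thesis
        using \<open>\<pi> m = N\<close> by auto
    qed
    then have "{w \<in> {J..<N}. w \<in> \<pi> ` P} = \<pi> ` P - {1..<J}"
      by force
    moreover have "card (\<pi> ` P) = card P"
      using permutes_inj[OF perm] by (intro card_image) (rule inj_on_subset, auto)
    ultimately show ?thesis
      using J low_values_subset_image[OF \<pi>] by (subst \<open>_ = _ - _\<close>, subst card_Diff_subset) auto
  qed
  ultimately show ?thesis
    by (simp add: mult.commute)
qed

text \<open>Each increase of \<open>J\<close> multiplies the count by
  \<open>(card P + 1 - J) / (N - J)\<close>, starting from \<open>fact (N - 1)\<close>. Denominators
  are cleared in order to stay within the natural numbers.\<close>

lemma card_low_in:
  assumes P: "P \<subseteq> {1..N} - {m}" and m: "m \<in> {1..N}" and J: "1 \<le> J" "J \<le> card P + 1"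
  shows "card (low_in N P J m) * fact (card P + 1 - J) = fact (N - J) * fact (card P)"
  using J
proof (induction J rule: nat_induct_at_least)
  case base
  then show ?case
    using card_low_in_1[OF m] by simp
next
  case (Suc J)
  \<comment> \<open>As \<open>P\<close> omits \<open>m\<close>, its size is at most
    \<open>N - 1\<close>; this gives \<open>J < N\<close>, so that the factor \<open>N - J\<close>
    can be cancelled.\<close>
  have "card P \<le> card ({1..N} - {m})"
    by (rule card_mono) (use P in auto)
  then have "J < N"
    using Suc m by simp
  obtain d where d: "N - J = Suc d"
    using \<open>J < N\<close> by (metis Suc_diff_Suc)
  obtain e where e: "card P + 1 - J = Suc e"
    using Suc by (metis Suc_diff_le Suc_eq_plus1 Suc_le_mono diff_Suc_Suc)
  have "Suc d * card (low_in N P (J + 1) m) = Suc e * card (low_in N P J m)"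
    using card_low_in_Suc[OF P, of J] Suc.hyps \<open>J < N\<close> d e by (simp del: mult_Suc)
  then have "Suc d * (card (low_in N P (J + 1) m) * fact e) = card (low_in N P J m) * fact (Suc e)"
    by (simp only: mult.assoc[symmetric] fact_Suc of_nat_id) (simp only: mult_ac)
  also have "\<dots> = fact (Suc d) * fact (card P)"
    using Suc.IH Suc.prems d e by simp
  finally have "card (low_in N P (J + 1) m) * fact e = fact d * fact (card P)"
    by (simp only: fact_Suc of_nat_id mult.assoc mult_cancel1) simp
  moreover have "N - Suc J = d" "card P + 1 - Suc J = e"
    using d e by auto
  ultimately show ?case
    by simp
qed

text \<open>Position \<open>m\<close> carries \<open>N\<close>, which is never a low value. This
  brings \<open>P\<close> into the form without \<open>m\<close> that \<open>card_low_in\<close>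
  requires.\<close>

lemma low_in_remove_max:
  assumes "J \<le> N"
  shows "low_in N (P - {m}) J m = low_in N P J m"
  using assms by (auto simp: low_in_def)

section \<open>The position of the maximum of a prefix\<close>

text \<open>Refines the count by the position \<open>j\<close> of the largest entry before
  \<open>N\<close>; rejectability amounts to \<open>j \<le> k < m\<close>.\<close>

definition argmax_at :: "nat \<Rightarrow> nat \<Rightarrow> nat \<Rightarrow> nat \<Rightarrow> nat \<Rightarrow> (nat \<Rightarrow> nat) set" where
  "argmax_at N I J m j = {\<pi> \<in> low_in N {1..I} J m. \<forall>i\<in>{1..<m}. \<pi> i \<le> \<pi> j}"

lemma finite_argmax_at [simp]: "finite (argmax_at N I J m j)"
  by (simp add: argmax_at_def)

text \<open>Uniqueness of the position of the maximum, phrased as a cardinality so that it can serve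
  as the inner sum of a double count.\<close>

lemma card_argmax:
  assumes "inj \<pi>" "1 < (m::nat)"
  shows "card {j \<in> {1..<m}. \<forall>i\<in>{1..<m}. \<pi> i \<le> (\<pi> j :: nat)} = 1"
proof -
  have "Max (\<pi> ` {1..<m}) \<in> \<pi> ` {1..<m}"
    using assms by (intro Max_in) auto
  then obtain j where j: "j \<in> {1..<m}" "\<pi> j = Max (\<pi> ` {1..<m})"
    by auto
  have "\<pi> i \<le> \<pi> j" if "i \<in> {1..<m}" for i
    using that unfolding j(2) by (intro Max_ge) auto
  then have "{j \<in> {1..<m}. \<forall>i\<in>{1..<m}. \<pi> i \<le> \<pi> j} = {j}"
    using j(1) assms(1) by (fastforce intro: antisym dest: injD)
  then show ?thesis
    by simp
qed

lemma low_in_inj: "\<pi> \<in> low_in N P J m \<Longrightarrow> inj \<pi>"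
  by (auto simp: low_in_def intro: permutes_inj)

text \<open>After the exchange position \<open>a\<close> carries \<open>\<pi> b\<close> and position
  \<open>b\<close> carries \<open>\<pi> a\<close>, which accounts for the two disjunctions. Keeping
  away from \<open>m\<close> leaves \<open>N\<close> in place.\<close>

lemma low_in_comp_transpose:
  assumes \<pi>: "\<pi> \<in> low_in N P J m" and ab: "a \<in> {1..N} - {m}" "b \<in> {1..N} - {m}"
    and "a \<in> P \<or> J \<le> \<pi> b" "b \<in> P \<or> J \<le> \<pi> a"
  shows "\<pi> \<circ> Transposition.transpose a b \<in> low_in N P J m"
proof -
  have "\<pi> \<circ> Transposition.transpose a b permutes {1..N}"
    using \<pi> ab by (intro permutes_comp_transpose) (auto simp: low_in_def)
  then show ?thesis
    using assms by (auto simp: low_in_def transpose_def)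
qed

lemma argmax_comp_transpose:
  assumes "\<forall>i\<in>{1..<m}. \<pi> i \<le> (\<pi> a :: nat)" "a \<in> {1..<m}" "b \<in> {1..<m::nat}"
  shows "\<forall>i\<in>{1..<m}. (\<pi> \<circ> Transposition.transpose a b) i \<le> (\<pi> \<circ> Transposition.transpose a b) b"
  using assms by (auto simp: transpose_def)

text \<open>All positions before \<open>m\<close> lie in \<open>{1..I}\<close> and may be exchanged
  freely, so each of these \<open>m - 1\<close> positions holds the maximum equally often.\<close>

lemma card_argmax_at_early:
  assumes "m \<le> I + 1" "m \<le> N" and j: "j \<in> {1..<m}"
  shows "(m - 1) * card (argmax_at N I J m j) = card (low_in N {1..I} J m)"
proof -
  have swap: "\<pi> \<circ> Transposition.transpose a b \<in> argmax_at N I J m b"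
    if "\<pi> \<in> argmax_at N I J m a" "a \<in> {1..<m}" "b \<in> {1..<m}" for \<pi> a b
    using that assms unfolding argmax_at_def mem_Collect_eq
    by (intro conjI low_in_comp_transpose argmax_comp_transpose) auto
  have "(\<Sum>\<pi>\<in>low_in N {1..I} J m. card {l \<in> {1..<m}. \<forall>i\<in>{1..<m}. \<pi> i \<le> \<pi> l}) =
      card (argmax_at N I J m j) * card {1..<m}"
  proof (rule sum_multicount)
    show "\<forall>l\<in>{1..<m}. card {\<pi> \<in> low_in N {1..I} J m. \<forall>i\<in>{1..<m}. \<pi> i \<le> \<pi> l} =
        card (argmax_at N I J m j)"
    proof
      fix l assume l: "l \<in> {1..<m}"
      have "card (argmax_at N I J m l) = card (argmax_at N I J m j)"
      proof (rule card_eq_involution[of _ "\<lambda>\<pi>. \<pi> \<circ> Transposition.transpose l j"])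
        fix \<pi>
        show "\<pi> \<in> argmax_at N I J m l \<Longrightarrow> \<pi> \<circ> Transposition.transpose l j \<in> argmax_at N I J m j"
          using l j by (intro swap)
        show "\<pi> \<in> argmax_at N I J m j \<Longrightarrow> \<pi> \<circ> Transposition.transpose l j \<in> argmax_at N I J m l"
          using l j by (subst transpose_commute) (intro swap)
      qed simp
      then show "card {\<pi> \<in> low_in N {1..I} J m. \<forall>i\<in>{1..<m}. \<pi> i \<le> \<pi> l} =
          card (argmax_at N I J m j)"
        by (simp add: argmax_at_def)
    qed
  qed auto
  moreover have "card {l \<in> {1..<m}. \<forall>i\<in>{1..<m}. \<pi> i \<le> \<pi> l} = 1"
    if "\<pi> \<in> low_in N {1..I} J m" for \<pi>
    using that j by (intro card_argmax low_in_inj[of \<pi>]) auto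
  ultimately show ?thesis
    by (simp add: mult.commute)
qed

text \<open>Only positions carrying values at least \<open>J\<close> may be exchanged freely. Both sides count the
  pairs of a permutation with its maximum over the first \<open>m - 1\<close> positions at \<open>j\<close> and a position
  \<open>l < m\<close> with value at least \<open>J\<close>; the exchange of \<open>j\<close> and \<open>l\<close> makes \<open>l\<close> the position of the
  maximum.\<close>

lemma card_argmax_at_late:
  assumes m: "I < m" "m \<le> N" and J: "1 \<le> J" "J \<le> N" and j: "j \<in> {1..I}"
  shows "(m - J) * card (argmax_at N I J m j) = card (low_in N ({1..I} - {j}) J m)"
proof -
  let ?G = "low_in N ({1..I} - {j}) J m"
  have G: "?G = {\<pi> \<in> low_in N {1..I} J m. J \<le> \<pi> j}"
    using m j by (auto simp: low_in_def)
  have swap: "\<pi> \<circ> Transposition.transpose a b \<in> {\<pi> \<in> argmax_at N I J m b. J \<le> \<pi> a}"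
    if \<pi>: "\<pi> \<in> {\<pi> \<in> argmax_at N I J m a. J \<le> \<pi> b}" and ab: "a \<in> {1..<m}" "b \<in> {1..<m}" for \<pi> a b
  proof -
    \<comment> \<open>The maximum at \<open>a\<close> is at least \<open>\<pi> b\<close>, so both
      exchanged entries are at least \<open>J\<close> and the exchange is admissible even when
      \<open>a\<close> or \<open>b\<close> lies beyond \<open>I\<close>.\<close>
    have "J \<le> \<pi> a"
      using \<pi> ab by (auto simp: argmax_at_def intro: le_trans)
    then show ?thesis
      using \<pi> ab m unfolding argmax_at_def mem_Collect_eq
      by (intro conjI low_in_comp_transpose argmax_comp_transpose) auto
  qed
  have "(\<Sum>\<pi>\<in>argmax_at N I J m j. card {l \<in> {1..<m}. J \<le> \<pi> l}) =
      (\<Sum>l = 1..<m. card {\<pi> \<in> argmax_at N I J m j. J \<le> \<pi> l})"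
    by (rule sum_multicount_gen) auto
  also have "\<dots> = (\<Sum>l = 1..<m. card {\<pi> \<in> ?G. \<forall>i\<in>{1..<m}. \<pi> i \<le> \<pi> l})"
  proof (intro sum.cong refl)
    fix l assume l: "l \<in> {1..<m}"
    have jm: "j \<in> {1..<m}"
      using j m by simp
    have "card {\<pi> \<in> argmax_at N I J m j. J \<le> \<pi> l} = card {\<pi> \<in> argmax_at N I J m l. J \<le> \<pi> j}"
    proof (rule card_eq_involution[of _ "\<lambda>\<pi>. \<pi> \<circ> Transposition.transpose j l"])
      fix \<pi>
      show "\<pi> \<in> {\<pi> \<in> argmax_at N I J m j. J \<le> \<pi> l} \<Longrightarrow>
          \<pi> \<circ> Transposition.transpose j l \<in> {\<pi> \<in> argmax_at N I J m l. J \<le> \<pi> j}"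
        using l jm by (intro swap)
      show "\<pi> \<in> {\<pi> \<in> argmax_at N I J m l. J \<le> \<pi> j} \<Longrightarrow>
          \<pi> \<circ> Transposition.transpose j l \<in> {\<pi> \<in> argmax_at N I J m j. J \<le> \<pi> l}"
        using l jm by (subst transpose_commute) (intro swap)
    qed simp
    also have "{\<pi> \<in> argmax_at N I J m l. J \<le> \<pi> j} = {\<pi> \<in> ?G. \<forall>i\<in>{1..<m}. \<pi> i \<le> \<pi> l}"
      unfolding G by (auto simp: argmax_at_def)
    finally show "card {\<pi> \<in> argmax_at N I J m j. J \<le> \<pi> l} =
        card {\<pi> \<in> ?G. \<forall>i\<in>{1..<m}. \<pi> i \<le> \<pi> l}" .
  qed
  also have "\<dots> = (\<Sum>\<pi>\<in>?G. card {l \<in> {1..<m}. \<forall>i\<in>{1..<m}. \<pi> i \<le> \<pi> l})"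
    by (rule sum_multicount_gen[symmetric]) auto
  also have "\<dots> = card ?G"
  proof -
    have "card {l \<in> {1..<m}. \<forall>i\<in>{1..<m}. \<pi> i \<le> \<pi> l} = 1" if "\<pi> \<in> ?G" for \<pi>
      using that j m by (intro card_argmax low_in_inj[of \<pi>]) auto
    then show ?thesis
      by simp
  qed
  finally have "(\<Sum>\<pi>\<in>argmax_at N I J m j. card {l \<in> {1..<m}. J \<le> \<pi> l}) = card ?G" .
  \<comment> \<open>All \<open>J - 1\<close> low values lie in the first \<open>I < m\<close>
    positions, hence among the \<open>m - 1\<close> positions considered.\<close>
  moreover have "card {l \<in> {1..<m}. J \<le> \<pi> l} = m - J" if "\<pi> \<in> argmax_at N I J m j" for \<pi>
  proof -
    have \<pi>: "\<pi> permutes {1..N}" and le: "\<And>i. i \<in> {1..N} - {1..I} \<Longrightarrow> J \<le> \<pi> i"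
      using that by (auto simp: argmax_at_def low_in_def)
    have sub: "{i \<in> {1..N}. \<pi> i < J} \<subseteq> {1..<m}"
    proof
      fix i assume i: "i \<in> {i \<in> {1..N}. \<pi> i < J}"
      then have "i \<in> {1..I}"
        using le[of i] by (cases "i \<le> I") auto
      then show "i \<in> {1..<m}"
        using m by simp
    qed
    have "{l \<in> {1..<m}. J \<le> \<pi> l} = {1..<m} - {i \<in> {1..N}. \<pi> i < J}"
      using m by auto
    then have "card {l \<in> {1..<m}. J \<le> \<pi> l} = card {1..<m} - card {i \<in> {1..N}. \<pi> i < J}"
      using sub by (simp only: card_Diff_subset finite_subset[OF sub finite_atLeastLessThan])
    also have "\<dots> = (m - 1) - (J - 1)"
      using J by (subst card_less_permutes[OF \<pi>]) simp_all
    finally show ?thesis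
      using J by simp
  qed
  ultimately show ?thesis
    by (simp add: mult.commute)
qed

section \<open>Acceptability and rejectability in a form suited to rearranging the prefix\<close>

text \<open>The maximum of the first \<open>m - 1\<close> entries is itself a left-to-right maximum,
  so without such maxima strictly between \<open>k\<close> and \<open>m\<close> it lies in the
  prefix. Conversely, a maximum in the prefix dominates every entry between \<open>k\<close> and
  \<open>m\<close>.\<close>

lemma rejectable_iff:
  assumes "inj \<pi>" "1 \<le> k"
  shows "rejectable N k q \<pi> \<longleftrightarrow> flattening k \<pi> = q \<and>
    (\<exists>m\<in>{k<..N}. \<pi> m = N \<and> (\<exists>j\<in>{1..k}. \<forall>i\<in>{1..<m}. \<pi> i \<le> \<pi> j))"
proof -
  have "(\<forall>i\<in>{k<..<m}. \<not> ltr_maximum \<pi> i) \<longleftrightarrow> (\<exists>j\<in>{1..k}. \<forall>i\<in>{1..<m}. \<pi> i \<le> \<pi> j)"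
    (is "?L \<longleftrightarrow> ?R") if m: "k < m" for m
  proof
    assume ?L
    have "card {j \<in> {1..<m}. \<forall>i\<in>{1..<m}. \<pi> i \<le> \<pi> j} = 1"
      using assms m by (intro card_argmax) auto
    then obtain j where "{j \<in> {1..<m}. \<forall>i\<in>{1..<m}. \<pi> i \<le> \<pi> j} = {j}"
      by (auto simp: card_1_singleton_iff)
    then have j: "j \<in> {1..<m}" "\<And>i. i \<in> {1..<m} \<Longrightarrow> \<pi> i \<le> \<pi> j"
      by blast+
    have "ltr_maximum \<pi> j"
      unfolding ltr_maximum_def
    proof
      fix i assume i: "i \<in> {1..<j}"
      then have "\<pi> i \<noteq> \<pi> j"
        using \<open>inj \<pi>\<close> by (auto dest: injD)
      then show "\<pi> i < \<pi> j"
        using j(2)[of i] i j(1) by simp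
    qed
    then have "j \<le> k"
      using \<open>?L\<close> j(1) by (force simp: not_le)
    then show ?R
      using j by (intro bexI[of _ j]) auto
  next
    assume ?R
    then obtain j where j: "j \<in> {1..k}" "\<forall>i\<in>{1..<m}. \<pi> i \<le> \<pi> j" ..
    show ?L
    proof
      fix i assume i: "i \<in> {k<..<m}"
      then have "\<pi> i \<le> \<pi> j" "j \<in> {1..<i}"
        using j by auto
      then show "\<not> ltr_maximum \<pi> i"
        by (auto simp: ltr_maximum_def not_less)
    qed
  qed
  then show ?thesis
    by (auto simp: rejectable_def)
qed

text \<open>Since \<open>p k = k\<close>, the last prefix entry is the largest one; if
  \<open>N\<close> occurs in the prefix at all, it must stand in position \<open>k\<close>.\<close>

lemma acceptable_iff:
  assumes \<pi>: "\<pi> permutes {1..N}" and p: "p permutes {1..k}" "p k = k" and "1 \<le> k" "k \<le> N"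
  shows "acceptable N k p \<pi> \<longleftrightarrow> flattening k \<pi> = p \<and> (\<exists>m\<in>{1..k}. \<pi> m = N)"
proof -
  have "\<pi> k = N" if "flattening k \<pi> = p" "m \<in> {1..k}" "\<pi> m = N" for m
  proof (rule ccontr)
    assume "\<pi> k \<noteq> N"
    then have "\<pi> k < \<pi> m"
      using that permutes_in_image[OF \<pi>, of k] assms by simp
    then have "flattening k \<pi> k < flattening k \<pi> m"
      using that assms by (subst flattening_less_iff) auto
    then show False
      using that permutes_in_image[OF p(1), of m] assms by simp
  qed
  then show ?thesis
    using assms by (auto simp: acceptable_def)
qed

section \<open>The tail sums of the counts\<close>

lemma card_UN_in_position:
  fixes A :: "nat \<Rightarrow> (nat \<Rightarrow> nat) set"
  assumes "finite M" "\<And>m. m \<in> M \<Longrightarrow> finite (A m)"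
    and "\<And>m \<pi>. m \<in> M \<Longrightarrow> \<pi> \<in> A m \<Longrightarrow> inj \<pi> \<and> \<pi> m = N"
  shows "card (\<Union>m\<in>M. A m) = (\<Sum>m\<in>M. card (A m))"
proof (rule card_UN_disjoint)
  show "\<forall>m\<in>M. \<forall>l\<in>M. m \<noteq> l \<longrightarrow> A m \<inter> A l = {}"
    using assms(3) unfolding disjoint_iff by (metis injD)
qed (use assms in auto)

lemma sum_sigma_tail:
  assumes "I < N" "1 \<le> k" "k \<le> I" "p permutes {1..k}" "p k = k" "J \<le> N"
  shows "fact k * (\<Sum>L = J..I + 1. sigma N I k p L) =
    (\<Sum>m = 1..k. card (low_in N ({1..I} - {m}) J m))"
proof -
  \<comment> \<open>The exact position of \<open>N\<close> is weakened to membership in the prefix,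
    which makes \<open>Q\<close> invariant under rearranging the first \<open>k\<close> positions;
    the flattening recovers the position.\<close>
  define Q where "Q \<pi> \<longleftrightarrow> (\<forall>i\<in>{I<..N}. J \<le> \<pi> i) \<and> (\<exists>m\<in>{1..k}. \<pi> m = N)" for \<pi> :: "nat \<Rightarrow> nat"
  have "(\<Sum>L = J..I + 1. sigma N I k p L) =
      card {\<pi>. \<pi> permutes {1..N} \<and> acceptable N k p \<pi> \<and> J \<le> J_statistic N I \<pi>}"
    unfolding sigma_def by (rule sum_card_J_statistic) fact
  also have "{\<pi>. \<pi> permutes {1..N} \<and> acceptable N k p \<pi> \<and> J \<le> J_statistic N I \<pi>} =
      {\<pi>. \<pi> permutes {1..N} \<and> flattening k \<pi> = p \<and> Q \<pi>}"
    using assms acceptable_iff[of _ N p k]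
    by (auto simp: Q_def le_J_statistic_iff)
  also have "fact k * card \<dots> = card {\<pi>. \<pi> permutes {1..N} \<and> Q \<pi>}"
  proof (rule card_flattening_fibre)
    fix \<pi> \<rho> :: "nat \<Rightarrow> nat" assume \<rho>: "\<rho> permutes {1..k}" and Q: "Q \<pi>"
    obtain m where "m \<in> {1..k}" "\<pi> m = N"
      using Q by (auto simp: Q_def)
    then have "\<exists>l\<in>{1..k}. \<pi> (\<rho> l) = N"
      using permutes_image[OF \<rho>] by (metis imageE)
    moreover have "\<rho> i = i" if "i \<in> {I<..N}" for i
      using that assms by (intro permutes_not_in[OF \<rho>]) auto
    ultimately show "Q (\<pi> \<circ> \<rho>)"
      using Q by (simp add: Q_def)
  qed (use assms in auto)
  also have "{\<pi>. \<pi> permutes {1..N} \<and> Q \<pi>} = (\<Union>m\<in>{1..k}. low_in N {1..I} J m)"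
  proof -
    have "{1..N} - {1..I} = {I<..N}"
      by auto
    then show ?thesis
      by (auto simp: Q_def low_in_def)
  qed
  also have "card \<dots> = (\<Sum>m = 1..k. card (low_in N {1..I} J m))"
    by (rule card_UN_in_position[where N = N]) (auto simp: low_in_def intro: permutes_inj)
  finally show ?thesis
    using \<open>J \<le> N\<close> by (simp add: low_in_remove_max)
qed

lemma sum_tau_tail:
  assumes "I < N" "1 \<le> k" "k \<le> I" "q permutes {1..k}"
  shows "fact k * (\<Sum>L = J..I + 1. tau N I k q L) =
    (\<Sum>m \<in> {k<..N}. \<Sum>j = 1..k. card (argmax_at N I J m j))"
proof -
  define Q where "Q \<pi> \<longleftrightarrow> (\<forall>i\<in>{I<..N}. J \<le> \<pi> i) \<and>
    (\<exists>m\<in>{k<..N}. \<pi> m = N \<and> (\<exists>j\<in>{1..k}. \<forall>i\<in>{1..<m}. \<pi> i \<le> \<pi> j))" for \<pi> :: "nat \<Rightarrow> nat"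
  have "(\<Sum>L = J..I + 1. tau N I k q L) =
      card {\<pi>. \<pi> permutes {1..N} \<and> rejectable N k q \<pi> \<and> J \<le> J_statistic N I \<pi>}"
    unfolding tau_def by (rule sum_card_J_statistic) fact
  also have "{\<pi>. \<pi> permutes {1..N} \<and> rejectable N k q \<pi> \<and> J \<le> J_statistic N I \<pi>} =
      {\<pi>. \<pi> permutes {1..N} \<and> flattening k \<pi> = q \<and> Q \<pi>}"
  proof (rule Collect_cong, rule conj_cong[OF refl])
    fix \<pi> assume "\<pi> permutes {1..N}"
    then show "rejectable N k q \<pi> \<and> J \<le> J_statistic N I \<pi> \<longleftrightarrow> flattening k \<pi> = q \<and> Q \<pi>"
      unfolding rejectable_iff[OF permutes_inj[OF \<open>\<pi> permutes _\<close>] \<open>1 \<le> k\<close>]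
        le_J_statistic_iff[OF \<open>\<pi> permutes _\<close> \<open>I < N\<close>] Q_def by blast
  qed
  also have "fact k * card \<dots> = card {\<pi>. \<pi> permutes {1..N} \<and> Q \<pi>}"
  proof (rule card_flattening_fibre)
    fix \<pi> \<rho> :: "nat \<Rightarrow> nat" assume \<rho>: "\<rho> permutes {1..k}" and Q: "Q \<pi>"
    obtain m j where m: "m \<in> {k<..N}" "\<pi> m = N" and j: "j \<in> {1..k}" "\<forall>i\<in>{1..<m}. \<pi> i \<le> \<pi> j"
      using Q by (auto simp: Q_def)
    have \<rho>_fix: "\<rho> i = i" if "k < i" for i
      using that by (intro permutes_not_in[OF \<rho>]) auto
    obtain l where l: "l \<in> {1..k}" "\<rho> l = j"
      using j(1) permutes_image[OF \<rho>] by (metis imageE)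
    \<comment> \<open>As \<open>k < m\<close>, the rearrangement acts within the first
      \<open>m - 1\<close> positions: their maximum stays the same and moves to \<open>l\<close>,
      which is again in the prefix.\<close>
    have \<rho>_m: "\<rho> permutes {1..<m}"
      using \<rho> by (rule permutes_subset) (use m in auto)
    have "\<forall>i\<in>{1..<m}. \<pi> (\<rho> i) \<le> \<pi> (\<rho> l)"
      unfolding l(2) using permutes_in_image[OF \<rho>_m] by (intro ballI bspec[OF j(2)]) (rule iffD2)
    then have "\<exists>m\<in>{k<..N}. (\<pi> \<circ> \<rho>) m = N \<and>
        (\<exists>l\<in>{1..k}. \<forall>i\<in>{1..<m}. (\<pi> \<circ> \<rho>) i \<le> (\<pi> \<circ> \<rho>) l)"
      using m l(1) \<rho>_fix[of m] by (intro bexI[of _ m] conjI bexI[of _ l]) auto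
    moreover have "\<forall>i\<in>{I<..N}. J \<le> (\<pi> \<circ> \<rho>) i"
      using Q \<rho>_fix \<open>k \<le> I\<close> by (simp add: Q_def)
    ultimately show "Q (\<pi> \<circ> \<rho>)"
      by (simp only: Q_def)
  qed (use assms in auto)
  also have "{\<pi>. \<pi> permutes {1..N} \<and> Q \<pi>} = (\<Union>m\<in>{k<..N}. \<Union>j\<in>{1..k}. argmax_at N I J m j)"
  proof -
    have "{1..N} - {1..I} = {I<..N}"
      by auto
    then show ?thesis
      by (auto simp: Q_def low_in_def argmax_at_def)
  qed
  also have "card \<dots> = (\<Sum>m\<in>{k<..N}. card (\<Union>j\<in>{1..k}. argmax_at N I J m j))"
    by (rule card_UN_in_position[where N = N]) (auto simp: argmax_at_def low_in_def intro: permutes_inj)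
  also have "\<dots> = (\<Sum>m\<in>{k<..N}. \<Sum>j = 1..k. card (argmax_at N I J m j))"
  proof (intro sum.cong refl card_UN_disjoint ballI impI)
    fix m i j assume *: "m \<in> {k<..N}" "i \<in> {1..k}" "j \<in> {1..k}" "i \<noteq> j"
    show "argmax_at N I J m i \<inter> argmax_at N I J m j = {}"
    proof (rule equals0I)
      fix \<pi> assume \<pi>: "\<pi> \<in> argmax_at N I J m i \<inter> argmax_at N I J m j"
      then have "\<pi> i = \<pi> j"
        using * by (intro antisym) (auto simp: argmax_at_def)
      moreover have "inj \<pi>"
        using \<pi> by (auto simp: argmax_at_def dest: low_in_inj)
      ultimately show False
        using \<open>i \<noteq> j\<close> by (auto dest: injD)
    qed
  qed auto
  finally show ?thesis .
qed

section \<open>Closed forms of the counts\<close>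

text \<open>Only \<open>I - 1\<close> positions admit low values. For \<open>J = I + 1\<close> there
  are \<open>I\<close> low values and the count vanishes, in accordance with the zero case of
  \<open>sigma_dot\<close>.\<close>

lemma card_low_in_remove:
  assumes "I < N" "a \<in> {1..I}" "m \<in> {1..N}" "a = m \<or> I < m" "1 \<le> J" "J \<le> I + 1"
  shows "real (card (low_in N ({1..I} - {a}) J m)) =
    (if J \<le> I then fact (N - J) * fact (I - 1) / fact (I - J) else 0)"
proof (cases "J \<le> I")
  case True
  have "card ({1..I} - {a}) = I - 1"
    using assms by simp
  moreover have "{1..I} - {a} \<subseteq> {1..N} - {m}"
    using assms by auto
  moreover have "I - 1 + 1 - J = I - J"
    using assms by simp
  ultimately have "card (low_in N ({1..I} - {a}) J m) * fact (I - J) = fact (N - J) * fact (I - 1)"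
    using card_low_in[of "{1..I} - {a}" N m J] assms True by simp
  then have "real (card (low_in N ({1..I} - {a}) J m) * fact (I - J)) =
      real (fact (N - J) * fact (I - 1))"
    by (simp only:)
  then have "real (card (low_in N ({1..I} - {a}) J m)) * fact (I - J) = fact (N - J) * fact (I - 1)"
    by (simp only: of_nat_mult of_nat_fact)
  then show ?thesis
    using True by (simp add: field_simps)
next
  case False
  then have "low_in N ({1..I} - {a}) J m = {}"
    using assms by (intro low_in_empty) auto
  then show ?thesis
    using False by simp
qed

text \<open>In both cases double counting leads to a \<open>low_in\<close> set with
  \<open>I - 1\<close> admissible positions, after removal of \<open>m\<close> when
  \<open>m \<le> I\<close> and of \<open>j\<close> otherwise; only the divisor differs.\<close>

lemma card_argmax_at:
  assumes "I < N" "j \<in> {1..I}" "j < m" "m \<le> N" "1 \<le> J" "J \<le> I"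
  shows "real (card (argmax_at N I J m j)) =
    fact (N - J) * fact (I - 1) / fact (I - J) / real (if m \<le> I then m - 1 else m - J)"
proof (cases "m \<le> I")
  case True
  have "(m - 1) * card (argmax_at N I J m j) = card (low_in N ({1..I} - {m}) J m)"
    using True assms by (subst card_argmax_at_early) (auto simp: low_in_remove_max)
  then have "real (m - 1) * card (argmax_at N I J m j) = card (low_in N ({1..I} - {m}) J m)"
    by (simp only: flip: of_nat_mult)
  also have "\<dots> = fact (N - J) * fact (I - 1) / fact (I - J)"
    using True assms by (subst card_low_in_remove) auto
  finally show ?thesis
    using True assms by (subst nonzero_eq_divide_eq) (auto simp: mult.commute)
next
  case False
  have "(m - J) * card (argmax_at N I J m j) = card (low_in N ({1..I} - {j}) J m)"
    using False assms by (intro card_argmax_at_late) auto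
  then have "real (m - J) * card (argmax_at N I J m j) = card (low_in N ({1..I} - {j}) J m)"
    by (simp only: flip: of_nat_mult)
  also have "\<dots> = fact (N - J) * fact (I - 1) / fact (I - J)"
    using False assms by (subst card_low_in_remove) auto
  finally show ?thesis
    using False assms by (subst nonzero_eq_divide_eq) (auto simp: mult.commute)
qed

text \<open>For \<open>J = I + 1\<close> the values \<open>1\<close> to \<open>I\<close> fill the
  first \<open>I\<close> positions. Thus \<open>N\<close> lies beyond \<open>I\<close>, and if
  \<open>m > I + 1\<close>, the entry in position \<open>I + 1\<close> already exceeds the one at
  \<open>j\<close>; only \<open>m = I + 1\<close> survives.\<close>

lemma card_argmax_at_last:
  assumes "I < N" "j \<in> {1..I}" "j < m" "m \<le> N"
  shows "real (card (argmax_at N I (I + 1) m j)) =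
    (if m = I + 1 then fact (N - (I + 1)) * fact (I - 1) else 0)"
proof -
  consider "m \<le> I" | "m = I + 1" | "I + 1 < m"
    by linarith
  then show ?thesis
  proof cases
    case 1
    have "(m - 1) * card (argmax_at N I (I + 1) m j) = card (low_in N ({1..I} - {m}) (I + 1) m)"
      using 1 assms by (subst card_argmax_at_early) (auto simp: low_in_remove_max)
    also have "low_in N ({1..I} - {m}) (I + 1) m = {}"
      using 1 assms by (intro low_in_empty) auto
    finally show ?thesis
      using 1 assms by simp
  next
    case 2
    \<comment> \<open>Here \<open>m - J = 0\<close>, so the identity for late \<open>m\<close> says
      nothing; the one for early \<open>m\<close> still applies, with
      \<open>m - 1 = I\<close>.\<close>
    have "I * card (argmax_at N I (I + 1) m j) = card (low_in N {1..I} (I + 1) m)"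
      using card_argmax_at_early[of m I N j "I + 1"] 2 assms by simp
    also have "\<dots> = fact (N - (I + 1)) * fact I"
    proof -
      have "{1..I} \<subseteq> {1..N} - {m}"
        using 2 assms by auto
      then show ?thesis
        using card_low_in[of "{1..I}" N m "I + 1"] 2 assms by simp
    qed
    also have "\<dots> = I * (fact (N - (I + 1)) * fact (I - 1))"
      using assms by (simp add: fact_reduce[of I])
    finally have "card (argmax_at N I (I + 1) m j) = fact (N - (I + 1)) * fact (I - 1)"
      using assms by (subst (asm) mult_cancel1) simp
    then show ?thesis
      using 2 by (simp only: of_nat_mult of_nat_fact simp_thms if_True)
  next
    case 3
    have "(m - (I + 1)) * card (argmax_at N I (I + 1) m j) =
        card (low_in N ({1..I} - {j}) (I + 1) m)"
      using 3 assms by (intro card_argmax_at_late) auto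
    also have "low_in N ({1..I} - {j}) (I + 1) m = {}"
      using 3 assms by (intro low_in_empty) auto
    finally show ?thesis
      using 3 by simp
  qed
qed

text \<open>Each of the \<open>k\<close> possible positions of \<open>N\<close> contributes the same
  count \<open>C\<close>, and \<open>k * C / fact k = C / fact (k - 1)\<close>.\<close>

lemma sigma_dot_eq:
  assumes "I < N" "1 \<le> k" "k \<le> I" "p permutes {1..k}" "p k = k" "1 \<le> J" "J \<le> I + 1"
  shows "sigma_dot N I k J = real (N choose (J - 1)) * (\<Sum>L = J..I + 1. real (sigma N I k p L))"
proof -
  define C :: real where "C = (if J \<le> I then fact (N - J) * fact (I - 1) / fact (I - J) else 0)"
  have "fact k * (\<Sum>L = J..I + 1. real (sigma N I k p L)) =
      real (fact k * (\<Sum>L = J..I + 1. sigma N I k p L))"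
    by (simp only: of_nat_mult of_nat_sum of_nat_fact)
  also have "\<dots> = (\<Sum>m = 1..k. real (card (low_in N ({1..I} - {m}) J m)))"
    using assms by (subst sum_sigma_tail[where J = J]) auto
  also have "\<dots> = (\<Sum>m = 1..k. C)"
    using assms by (intro sum.cong refl) (subst card_low_in_remove, auto simp: C_def)
  also have "\<dots> = fact k * (C / fact (k - 1))"
    using assms by (simp add: fact_reduce[of k])
  finally have "(\<Sum>L = J..I + 1. real (sigma N I k p L)) = C / fact (k - 1)"
    by (subst (asm) mult_cancel_left) simp
  then show ?thesis
    by (simp only: sigma_dot_def C_def) simp
qed

lemma tau_dot_eq:
  assumes "I < N" "1 \<le> k" "k \<le> I" "q permutes {1..k}" "1 \<le> J" "J \<le> I + 1"
  shows "tau_dot N I k J = real (N choose (J - 1)) * (\<Sum>L = J..I + 1. real (tau N I k q L))"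
proof -
  let ?T = "\<Sum>L = J..I + 1. real (tau N I k q L)"
  have T: "fact k * ?T = (\<Sum>m\<in>{k<..N}. \<Sum>j = 1..k. real (card (argmax_at N I J m j)))"
  proof -
    have "fact k * ?T = real (fact k * (\<Sum>L = J..I + 1. tau N I k q L))"
      by (simp only: of_nat_mult of_nat_sum of_nat_fact)
    also have "\<dots> = (\<Sum>m\<in>{k<..N}. \<Sum>j = 1..k. real (card (argmax_at N I J m j)))"
      using assms by (subst sum_tau_tail) auto
    finally show ?thesis .
  qed
  have fact_k: "fact k = real k * fact (k - 1)"
    using assms by (simp add: fact_reduce)
  \<comment> \<open>The formula for \<open>k < I\<close> also covers \<open>k = I\<close>: the
    quotient of factorials becomes \<open>1\<close> and the sum from \<open>k\<close> to
    \<open>I - 1\<close> is empty.\<close>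
  have tau_dot: "tau_dot N I k J = fact (I - 1) / fact (k - 1) * tau_dot_top N I J +
      sigma_dot N I k J * (\<Sum>i = k..I - 1. 1 / real i)"
    using assms by (auto simp: tau_dot_def)
  show ?thesis
  proof (cases "J \<le> I")
    case True
    define C :: real where "C = fact (N - J) * fact (I - 1) / fact (I - J)"
    \<comment> \<open>The first sum comes from the positions \<open>m \<le> I\<close> of
      \<open>N\<close>, with divisor \<open>m - 1\<close>; the second comes from
      \<open>m > I\<close>, with divisor \<open>m - J\<close>.\<close>
    define S where "S = (\<Sum>i = k..I - 1. 1 / real i) + (\<Sum>i = I - J + 1..N - J. 1 / real i)"
    have "fact k * ?T = (\<Sum>m\<in>{k<..N}. \<Sum>j = 1..k. C / real (if m \<le> I then m - 1 else m - J))"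
      unfolding T using assms True
      by (intro sum.cong refl) (subst card_argmax_at, auto simp: C_def)
    also have "\<dots> = real k * C * (\<Sum>m\<in>{k<..N}. 1 / real (if m \<le> I then m - 1 else m - J))"
      by (simp add: sum_distrib_left)
    also have "(\<Sum>m\<in>{k<..N}. 1 / real (if m \<le> I then m - 1 else m - J)) = S"
    proof -
      have "{k<..N} = {k<..I} \<union> {I<..N}"
        using assms by auto
      then have "(\<Sum>m\<in>{k<..N}. 1 / real (if m \<le> I then m - 1 else m - J)) =
          (\<Sum>m\<in>{k<..I}. 1 / real (m - 1)) + (\<Sum>m\<in>{I<..N}. 1 / real (m - J))"
        by (simp only:) (subst sum.union_disjoint, auto intro!: arg_cong2[of _ _ _ _ "(+)"] sum.cong)
      also have "(\<Sum>m\<in>{k<..I}. 1 / real (m - 1)) = (\<Sum>i = k..I - 1. 1 / real i)"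
        using assms by (intro sum.reindex_bij_witness[of _ "\<lambda>i. i + 1" "\<lambda>m. m - 1"]) auto
      also have "(\<Sum>m\<in>{I<..N}. 1 / real (m - J)) = (\<Sum>i = I - J + 1..N - J. 1 / real i)"
        using assms True by (intro sum.reindex_bij_witness[of _ "\<lambda>i. i + J" "\<lambda>m. m - J"]) auto
      finally show ?thesis
        by (simp only: S_def)
    qed
    also have "real k * C * S = fact k * (C * S / fact (k - 1))"
      by (simp add: fact_k)
    finally have "?T = C * S / fact (k - 1)"
      by (subst (asm) mult_cancel_left) simp
    then show ?thesis
      unfolding tau_dot using True
      by (simp only: tau_dot_top_def sigma_dot_def C_def S_def if_True) (simp add: field_simps)
  next
    case False
    then have J: "J = I + 1"
      using assms by simp
    have "fact k * ?T = (\<Sum>m\<in>{k<..N}. \<Sum>j = 1..k.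
        if m = I + 1 then fact (N - (I + 1)) * fact (I - 1) else 0)"
      unfolding T unfolding J using assms
      by (intro sum.cong refl) (subst card_argmax_at_last, auto)
    also have "\<dots> = (\<Sum>m\<in>{k<..N}.
        if m = I + 1 then real k * (fact (N - (I + 1)) * fact (I - 1)) else 0)"
      by (intro sum.cong) auto
    also have "\<dots> = fact k * (fact (N - J) * fact (I - 1) / fact (k - 1))"
      using assms by (simp add: J fact_k)
    finally have "?T = fact (N - J) * fact (I - 1) / fact (k - 1)"
      by (subst (asm) mult_cancel_left) simp
    then show ?thesis
      \<comment> \<open>At \<open>J = I + 1\<close> the term with \<open>sigma_dot\<close> vanishes,
        and the second displayed form of the top value matches the count directly.\<close>
      unfolding tau_dot tau_dot_top_last[OF \<open>I < N\<close> J] by (simp add: sigma_dot_def J)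
  qed
qed

theorem theorem5p2:
  fixes N I k :: nat and p q :: "nat \<Rightarrow> nat" and x :: real
  assumes "1 \<le> I" and "I < N" and "1 \<le> k" and "k \<le> I"
    and "p permutes {1..k}" and "p k = k"
    and "q permutes {1..k}"
  shows "(\<Sum>J = 1..I + 1. sigma_dot N I k J * poly (R_dot_poly I J) x) =
           fact N * (\<Sum>J = 1..I + 1. real (sigma N I k p J) * poly (R_poly N I J) x)
    \<and> (\<Sum>J = 1..I + 1. tau_dot N I k J * poly (R_dot_poly I J) x) =
           fact N * (\<Sum>J = 1..I + 1. real (tau N I k q J) * poly (R_poly N I J) x)"
  using assms
  by (intro conjI sum_R_dot_poly_eq_sum_R_poly sigma_dot_eq tau_dot_eq) simp_all

end
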